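(* Let $\{h_\phi:\mathbb{R}^D\to\mathbb{R}^d\}_{\phi\in\Phi}$ be a family of injective functions, let $\kappa_\psi=\kappa_{\psi_1}+\kappa_{\psi_2}$ be the KernelNet kernel on $\mathbb{R}^d\times\mathbb{R}^d$ built from the random vectors $\omega_{\psi_1}$ and $\omega_{\psi_2,z_1,z_2}$ (see context), and let $\mathrm{MMD}_{\phi,\psi}$ denote the maximum mean discrepancy between probability distributions on $\mathbb{R}^D$ with kernel $k_{\phi,\psi}(x,y)=\kappa_\psi(h_\phi(x),h_\phi(y))$. Suppose that, for $z_1,z_2\in\mathbb{R}^d$, $$\mathbb{E}_{\omega_{\psi_1}}\left[\|\omega_{\psi_1}\|^2\right]<\infty,\qquad \mathbb{E}_{\omega_{\psi_2,z_1,z_2}}\left[\|\omega_{\psi_2,z_1,z_2}\|^2\right]<\infty,$$ $$\mathbb{E}_{\omega_{\psi_2,z_1,z_2}}\left[\left\|\frac{\partial \omega_{\psi_2,z_1,z_2}}{\partial z_1}-\frac{\partial \omega_{\psi_2,z_1,z_2}}{\partial z_2}\right\|_{\mathcal F}\right]<\infty,\qquad \sup_{\phi\in\Phi}\|h_\phi\|_{\mathrm{Lip}}<\infty .$$ Then, for $\phi\in\Phi$, $\mathrm{MMD}_{\phi,\psi}(\mathbb{P},\mathbb{Q})$ is continuous in the weak topology; that is, $\mathbb{Q}\xrightarrow{D}\mathbb{P}$ implies $\mathrm{MMD}_{\phi,\psi}(\mathbb{P},\mathbb{Q})\to 0$.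
   Context: KernelNet. Let $\psi=(\psi_1,\psi_2)$ with $\psi_2=(\psi_2^1,\psi_2^2)$ be neural network parameters. (i) Data-independent part: $\omega_{\psi_1}=g_{\psi_1}(\epsilon)\in\mathbb{R}^d$, where $g_{\psi_1}$ is a deep neural network and $\epsilon$ is drawn from a simple distribution (uniform $\mathcal U[-\mathbf 1,\mathbf 1]$ or standard Gaussian). (ii) Data-dependent part: for $z_1,z_2\in\mathbb{R}^d$, $\omega_{\psi_2,z_1,z_2}=\mu_{\psi_2,z_1,z_2}+\epsilon\odot\sigma_{\psi_2,z_1,z_2}$ with $\epsilon\sim\mathcal U[-\mathbf 1,\mathbf 1]$ (uniform on $[-1,1]^d$), $\mu_{\psi_2,z_1,z_2}=t_{\psi_2^1}(z_1)+t_{\psi_2^1}(z_2)$, $\sigma_{\psi_2,z_1,z_2}=\exp(t_{\psi_2^2}(z_1)+t_{\psi_2^2}(z_2))$, where $t_{\psi_2^1},t_{\psi_2^2}:\mathbb{R}^d\to\mathbb{R}^d$ are (differentiable) neural networks, $\odot$ is the element-wise product and $\exp$ is element-wise. Derivatives of $\omega_{\psi_2,z_1,z_2}$ with respect to $z_1$ and $z_2$ are taken with $\epsilon$ held fixed, and expectations over $\omega_{\psi_2,z_1,z_2}$ are expectations over $\epsilon$. With $b\sim\mathcal U[0,2\pi]$ independent of these, the kernels are $$\kappa_{\psi_1}(z_1,z_2)=\mathbb{E}_{\omega_{\psi_1},b}\left[2\cos(\omega_{\psi_1}^{\top}z_1+b)\cos(\omega_{\psi_1}^{\top}z_2+b)\right],$$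 $$\kappa_{\psi_2}(z_1,z_2)=\mathbb{E}_{\omega_{\psi_2,z_1,z_2},b}\left[2\cos(\omega_{\psi_2,z_1,z_2}^{\top}z_1+b)\cos(\omega_{\psi_2,z_1,z_2}^{\top}z_2+b)\right],$$ and $\kappa_\psi=\kappa_{\psi_1}+\kappa_{\psi_2}$. MMD. For a kernel $k$ with reproducing kernel Hilbert space $\mathcal H$, $\mathrm{MMD}_k(\mathbb{P},\mathbb{Q})=\sup_{\|f\|_{\mathcal H}\le 1}\left(\mathbb{E}_{x\sim\mathbb{P}}[f(x)]-\mathbb{E}_{y\sim\mathbb{Q}}[f(y)]\right)$, which is computed by $\mathrm{MMD}_k^2(\mathbb{P},\mathbb{Q})=\mathbb{E}_{x,x'\sim\mathbb{P}}[k(x,x')]-2\,\mathbb{E}_{x\sim\mathbb{P},y\sim\mathbb{Q}}[k(x,y)]+\mathbb{E}_{y,y'\sim\mathbb{Q}}[k(y,y')]$ (all samples independent). Continuity in weak topology: $\mathrm{MMD}_k$ is continuous in the weak topology if $\mathbb{Q}\xrightarrow{D}\mathbb{P}$ (convergence in distribution) implies $\mathrm{MMD}_k(\mathbb{Q},\mathbb{P})\to 0$. Notation: $\|\cdot\|$ is the Euclidean norm, $\|\cdot\|_{\mathcal F}$ the Frobenius norm of a matrix, and $\|h_\phi\|_{\mathrm{Lip}}$ the Lipschitz constant of $h_\phi$. *)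

theory Defs
  imports "HOL-Probability.Probability"
begin

text \<open>
  The networks enter as functions \<open>g\<close> and \<open>t\<close> taking a parameter and an input.  No architecture
  is fixed.  The full parameter is \<open>\<psi> = (\<psi>1, \<psi>21, \<psi>22)\<close>.
\<close>

text \<open>On \<open>real^'d\<close> the constant \<open>1\<close> is the all-ones vector, and \<open>*\<close> is the element-wise product.\<close>

definition uniform_cube :: "(real^'d) measure" where
  "uniform_cube = uniform_measure lborel (cbox (-1) 1)"

definition std_gaussian :: "(real^'d) measure" where
  "std_gaussian = density lborel (\<lambda>x. ennreal (\<Prod>i\<in>UNIV. std_normal_density (x $ i)))"

definition uniform_phase :: "real measure" where
  "uniform_phase = uniform_measure lborel {0..2 * pi}"

definition exp_vec :: "real^'d \<Rightarrow> real^'d" where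
  "exp_vec v = (\<chi> i. exp (v $ i))"

definition mu2 :: "('q \<Rightarrow> real^'d \<Rightarrow> real^'d) \<Rightarrow> 'q \<times> 'q \<Rightarrow> real^'d \<Rightarrow> real^'d \<Rightarrow> real^'d" where
  "mu2 t \<psi>2 z1 z2 = t (fst \<psi>2) z1 + t (fst \<psi>2) z2"

definition sigma2 :: "('q \<Rightarrow> real^'d \<Rightarrow> real^'d) \<Rightarrow> 'q \<times> 'q \<Rightarrow> real^'d \<Rightarrow> real^'d \<Rightarrow> real^'d" where
  "sigma2 t \<psi>2 z1 z2 = exp_vec (t (snd \<psi>2) z1 + t (snd \<psi>2) z2)"

definition omega2 ::
  "('q \<Rightarrow> real^'d \<Rightarrow> real^'d) \<Rightarrow> 'q \<times> 'q \<Rightarrow> real^'d \<Rightarrow> real^'d \<Rightarrow> real^'d \<Rightarrow> real^'d" where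
  "omega2 t \<psi>2 \<epsilon> z1 z2 = mu2 t \<psi>2 z1 z2 + \<epsilon> * sigma2 t \<psi>2 z1 z2"

text \<open>\<open>\<nu>\<close> is the law of the noise fed to \<open>g\<close>; its dimension \<open>'m\<close> is unrelated to \<open>'d\<close>.\<close>

definition kappa1 ::
  "(real^'m) measure \<Rightarrow> ('p \<Rightarrow> real^'m \<Rightarrow> real^'d) \<Rightarrow> 'p \<Rightarrow> real^'d \<Rightarrow> real^'d \<Rightarrow> real" where
  "kappa1 \<nu> g \<psi>1 z1 z2 =
     (\<integral>(\<epsilon>, b). 2 * cos (g \<psi>1 \<epsilon> \<bullet> z1 + b) * cos (g \<psi>1 \<epsilon> \<bullet> z2 + b) \<partial>(\<nu> \<Otimes>\<^sub>M uniform_phase))"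

definition kappa2 ::
  "('q \<Rightarrow> real^'d \<Rightarrow> real^'d) \<Rightarrow> 'q \<times> 'q \<Rightarrow> real^'d \<Rightarrow> real^'d \<Rightarrow> real" where
  "kappa2 t \<psi>2 z1 z2 =
     (\<integral>(\<epsilon>, b). 2 * cos (omega2 t \<psi>2 \<epsilon> z1 z2 \<bullet> z1 + b) * cos (omega2 t \<psi>2 \<epsilon> z1 z2 \<bullet> z2 + b)
        \<partial>(uniform_cube \<Otimes>\<^sub>M uniform_phase))"

definition kappa ::
  "(real^'m) measure \<Rightarrow> ('p \<Rightarrow> real^'m \<Rightarrow> real^'d) \<Rightarrow> ('q \<Rightarrow> real^'d \<Rightarrow> real^'d)
     \<Rightarrow> 'p \<times> ('q \<times> 'q) \<Rightarrow> real^'d \<Rightarrow> real^'d \<Rightarrow> real" where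
  "kappa \<nu> g t \<psi> z1 z2 = kappa1 \<nu> g (fst \<psi>) z1 z2 + kappa2 t (snd \<psi>) z1 z2"

text \<open>
  The Jacobian of \<open>\<omega>\<close> in \<open>z1\<close> minus the Jacobian in \<open>z2\<close>, with \<open>\<epsilon>\<close> held fixed.  The
  \<open>norm\<close> of a matrix of type \<open>real^'n^'m\<close> is its Frobenius norm.
\<close>

definition jacobian_diff ::
  "('q \<Rightarrow> real^'d \<Rightarrow> real^'d) \<Rightarrow> 'q \<times> 'q \<Rightarrow> real^'d \<Rightarrow> real^'d \<Rightarrow> real^'d \<Rightarrow> real^'d^'d" where
  "jacobian_diff t \<psi>2 \<epsilon> z1 z2 =
     jacobian (\<lambda>z. omega2 t \<psi>2 \<epsilon> z z2) (at z1) - jacobian (\<lambda>z. omega2 t \<psi>2 \<epsilon> z1 z) (at z2)"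

text \<open>The least Lipschitz constant, with value \<open>\<infinity>\<close> if the function is not Lipschitz.\<close>

definition lip_const :: "('a::metric_space \<Rightarrow> 'b::metric_space) \<Rightarrow> ennreal" where
  "lip_const h = (INF L\<in>{L. L-lipschitz_on UNIV h}. ennreal L)"

text \<open>
  \<open>H\<close> is a set of functions with inner product \<open>ip\<close>, of which only the values on \<open>H\<close> matter.
  By Moore--Aronszajn, such a pair exists iff \<open>k\<close> is positive semidefinite, and \<open>H\<close> and the
  restriction of \<open>ip\<close> to \<open>H\<close> are then uniquely determined by \<open>k\<close>.
\<close>

definition rkhs_norm :: "(('a \<Rightarrow> real) \<Rightarrow> ('a \<Rightarrow> real) \<Rightarrow> real) \<Rightarrow> ('a \<Rightarrow> real) \<Rightarrow> real" where
  "rkhs_norm ip f = sqrt (ip f f)"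

locale rkhs =
  fixes H :: "('a \<Rightarrow> real) set"
    and ip :: "('a \<Rightarrow> real) \<Rightarrow> ('a \<Rightarrow> real) \<Rightarrow> real"
    and k :: "'a \<Rightarrow> 'a \<Rightarrow> real"
  assumes zero_mem: "(\<lambda>x. 0) \<in> H"
    and add_mem: "\<lbrakk>f \<in> H; f' \<in> H\<rbrakk> \<Longrightarrow> (\<lambda>x. f x + f' x) \<in> H"
    and scale_mem: "f \<in> H \<Longrightarrow> (\<lambda>x. c * f x) \<in> H"
    and ip_sym: "\<lbrakk>f \<in> H; f' \<in> H\<rbrakk> \<Longrightarrow> ip f f' = ip f' f"
    and ip_add: "\<lbrakk>f \<in> H; f' \<in> H; u \<in> H\<rbrakk> \<Longrightarrow> ip (\<lambda>x. f x + f' x) u = ip f u + ip f' u"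
    and ip_scale: "\<lbrakk>f \<in> H; u \<in> H\<rbrakk> \<Longrightarrow> ip (\<lambda>x. c * f x) u = c * ip f u"
    and ip_nonneg: "f \<in> H \<Longrightarrow> 0 \<le> ip f f"
    and ip_definite: "\<lbrakk>f \<in> H; ip f f = 0\<rbrakk> \<Longrightarrow> f = (\<lambda>x. 0)"
    and complete:
      "\<lbrakk>\<And>n. s n \<in> H;
        \<And>e. e > 0 \<Longrightarrow> \<exists>N. \<forall>m\<ge>N. \<forall>n\<ge>N. rkhs_norm ip (\<lambda>x. s m x - s n x) < e\<rbrakk>
       \<Longrightarrow> \<exists>f\<in>H. (\<lambda>n. rkhs_norm ip (\<lambda>x. s n x - f x)) \<longlonglongrightarrow> 0"
    and kernel_mem: "k x \<in> H"
    and reproducing: "f \<in> H \<Longrightarrow> ip f (k x) = f x"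

text \<open>The supremum is taken in \<open>ereal\<close>, so that no boundedness is presupposed.\<close>

definition mmd ::
  "('a \<Rightarrow> real) set \<Rightarrow> (('a \<Rightarrow> real) \<Rightarrow> ('a \<Rightarrow> real) \<Rightarrow> real)
     \<Rightarrow> 'a measure \<Rightarrow> 'a measure \<Rightarrow> ereal" where
  "mmd H ip P Q = (SUP f\<in>{f \<in> H. rkhs_norm ip f \<le> 1}. ereal ((\<integral>x. f x \<partial>P) - (\<integral>y. f y \<partial>Q)))"

text \<open>
  The expectation formula for the squared discrepancy, which makes sense for every bounded
  measurable \<open>k\<close>, positive semidefinite or not.
\<close>

definition mmd_sq :: "('a \<Rightarrow> 'a \<Rightarrow> real) \<Rightarrow> 'a measure \<Rightarrow> 'a measure \<Rightarrow> real" where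
  "mmd_sq k P Q =
     (\<integral>(x, x'). k x x' \<partial>(P \<Otimes>\<^sub>M P)) - 2 * (\<integral>(x, y). k x y \<partial>(P \<Otimes>\<^sub>M Q))
       + (\<integral>(y, y'). k y y' \<partial>(Q \<Otimes>\<^sub>M Q))"

text \<open>The library's \<open>weak_conv_m\<close> covers measures on the real line only.\<close>

definition converges_in_distribution ::
  "(nat \<Rightarrow> 'a::topological_space measure) \<Rightarrow> 'a measure \<Rightarrow> bool" where
  "converges_in_distribution Q P \<longleftrightarrow>
     (\<forall>f :: 'a \<Rightarrow> real. continuous_on UNIV f \<longrightarrow> bounded (range f) \<longrightarrow>
        (\<lambda>n. \<integral>x. f x \<partial>(Q n)) \<longlonglongrightarrow> (\<integral>x. f x \<partial>P))"

definition borel_prob :: "'a::topological_space measure \<Rightarrow> bool" where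
  "borel_prob P \<longleftrightarrow> prob_space P \<and> sets P = sets borel"

end

theory Submission
  imports Defs
begin

text \<open>
  By dominated convergence the kernel is bounded and jointly continuous.  Hence, by the
  reproducing property, the unit ball of its reproducing kernel Hilbert space is uniformly bounded
  and equicontinuous.  Weak convergence is uniform over such a family: on a compact set carrying
  most of the mass of \<open>P\<close>, a finite partition of unity approximates all members at once by
  combinations of finitely many fixed continuous functions.  For the expectation formula, the same
  uniformity applied to the sections \<open>k(\<cdot>, y)\<close>, with \<open>y\<close> in a ball, gives convergence of the
  double integrals without positive definiteness of \<open>k\<close>.
\<close>


subsection \<open>Uniform weak convergence\<close>

text \<open>First countability reduces continuity to sequences, and for these dominated convergence
  applies: the constant \<open>B\<close> is integrable because \<open>M\<close> is finite.\<close>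

lemma continuous_on_integral_bounded:
  fixes f :: "'b::{first_countable_topology, t2_space} \<Rightarrow> 'a \<Rightarrow> real"
  assumes M: "finite_measure M"
    and meas: "\<And>z. f z \<in> borel_measurable M"
    and cont: "\<And>a. continuous_on UNIV (\<lambda>z. f z a)"
    and bound: "\<And>z a. \<bar>f z a\<bar> \<le> B"
  shows "continuous_on UNIV (\<lambda>z. \<integral>a. f z a \<partial>M)"
proof -
  interpret finite_measure M by (rule M)
  have "(\<lambda>n. \<integral>a. f (u n) a \<partial>M) \<longlonglongrightarrow> (\<integral>a. f z a \<partial>M)" if u: "u \<longlonglongrightarrow> z" for u z
  proof (rule integral_dominated_convergence[where w="\<lambda>_. B"])
    have "(\<lambda>n. f (u n) a) \<longlonglongrightarrow> f z a" for a
      by (rule continuous_on_tendsto_compose[OF cont u]) simp_all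
    then show "AE a in M. (\<lambda>n. f (u n) a) \<longlonglongrightarrow> f z a" by simp
    show "AE a in M. norm (f (u n) a) \<le> B" for n using bound by simp
  qed (simp_all add: meas)
  then show ?thesis
    by (rule continuous_on_sequentiallyI)
qed

lemma abs_integral_le_bound:
  fixes f :: "'a \<Rightarrow> real"
  assumes "prob_space M" and bound: "\<And>x. \<bar>f x\<bar> \<le> B"
  shows "\<bar>\<integral>x. f x \<partial>M\<bar> \<le> B"
proof (cases "integrable M f")
  case True
  interpret prob_space M by fact
  have "\<bar>\<integral>x. f x \<partial>M\<bar> \<le> (\<integral>x. \<bar>f x\<bar> \<partial>M)" by (rule integral_abs_bound)
  also have "\<dots> \<le> B" using True bound by (intro integral_le_const) auto
  finally show ?thesis .
next
  \<comment> \<open>The integral of a non-integrable function is 0 by convention, and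
    \<open>B\<close> is nonnegative since it bounds an absolute value.\<close>
  case False
  then show ?thesis
    using order_trans[OF abs_ge_zero bound] by (simp add: not_integrable_integral_eq)
qed

lemma integrable_continuous_bounded:
  fixes f :: "'a::topological_space \<Rightarrow> real"
  assumes M: "borel_prob M" and cont: "continuous_on UNIV f" and bound: "\<And>x. \<bar>f x\<bar> \<le> B"
  shows "integrable M f"
proof -
  interpret prob_space M using M by (simp add: borel_prob_def)
  have "f \<in> borel_measurable M"
    using M borel_measurable_continuous_onI[OF cont] by (simp add: borel_prob_def cong: measurable_cong_sets)
  then show ?thesis
    using bound by (intro integrable_const_bound[where B=B]) auto
qed

text \<open>The complements of the closed balls around a fixed point decrease to the empty set, so
  their mass tends to 0; closed balls are compact in a Heine-Borel space.\<close>

lemma borel_prob_tight: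
  fixes P :: "'a::heine_borel measure"
  assumes P: "borel_prob P" and e: "e > 0"
  obtains K where "compact K" "K \<noteq> {}" "measure P (- K) < e"
proof -
  interpret prob_space P using P by (simp add: borel_prob_def)
  have sets: "sets P = sets borel" and space: "space P = UNIV"
    using P by (auto simp: borel_prob_def dest: sets_eq_imp_space_eq)
  fix x0 :: 'a
  define A where "A n = - cball x0 (real n)" for n
  have "(\<Inter>n. A n) = {}"
    by (auto simp: A_def not_le) (meson not_le real_arch_simple)
  moreover have "(\<lambda>n. measure P (A n)) \<longlonglongrightarrow> measure P (\<Inter>n. A n)"
    by (rule finite_Lim_measure_decseq) (auto simp: A_def sets decseq_def)
  ultimately have "eventually (\<lambda>n. measure P (A n) < e) sequentially"
    using e by (simp add: order_tendsto_iff)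
  then obtain n where "measure P (A n) < e"
    by (auto simp: eventually_sequentially)
  then show thesis
    by (intro that[of "cball x0 (real n)"]) (auto simp: A_def)
qed

text \<open>The function \<tau> lies below the indicator of \<open>- K\<close>. Unlike the indicator
  it is continuous, so weak convergence carries its small integral from \<open>P\<close> to
  \<open>Q n\<close>.\<close>

lemma integral_tail_less:
  fixes P :: "'a::heine_borel measure"
  assumes P: "borel_prob P" and K: "compact K" "measure P (- K) < b"
    and cont: "continuous_on UNIV \<tau>" and zero: "\<And>y. y \<in> K \<Longrightarrow> \<tau> y = 0" and bound: "\<And>y. \<bar>\<tau> y\<bar> \<le> (1::real)"
  shows "(\<integral>y. \<tau> y \<partial>P) < b"
proof -
  interpret prob_space P using P by (simp add: borel_prob_def)
  have sets: "sets P = sets borel" using P by (simp add: borel_prob_def)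
  have "\<tau> y \<le> indicator (- K) y" for y
    using bound[of y] zero[of y] by (cases "y \<in> K") (auto simp: abs_le_iff)
  then have "(\<integral>y. \<tau> y \<partial>P) \<le> (\<integral>y. indicator (- K) y \<partial>P)"
    using integrable_continuous_bounded[OF P cont bound] K
    by (intro integral_mono) (auto simp: sets compact_imp_closed less_top[symmetric])
  also have "\<dots> = measure P (- K)"
    using P sets_eq_imp_space_eq[OF sets] by simp
  finally show ?thesis using K by simp
qed

text \<open>A member \<open>f\<close> enters its approximant
  \<open>\<Sum>x\<in>X. f x * w x y\<close> only through finitely many coefficients bounded by
  \<open>B\<close>. Convergence of the integrals of the \<open>w x\<close> and of \<tau>, none of
  which depends on \<open>f\<close>, therefore serves all of \<open>F\<close> at once.\<close>

lemma uniform_weak_convergence: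
  fixes P :: "'a::heine_borel measure" and F :: "('a \<Rightarrow> real) set"
  assumes P: "borel_prob P" and Q: "\<And>n. borel_prob (Q n)"
    and conv: "converges_in_distribution Q P"
    and equi: "\<And>x e. e > 0 \<Longrightarrow> \<exists>d>0. \<forall>f\<in>F. \<forall>y. dist x y < d \<longrightarrow> \<bar>f y - f x\<bar> \<le> e"
    and bound: "\<And>f x. f \<in> F \<Longrightarrow> \<bar>f x\<bar> \<le> B"
    and e: "e > 0"
  shows "\<forall>\<^sub>F n in sequentially. \<forall>f\<in>F. \<bar>(\<integral>x. f x \<partial>P) - (\<integral>x. f x \<partial>Q n)\<bar> \<le> e"
proof (cases "F = {}")
  case False
  then have B0: "B \<ge> 0" using bound by (meson abs_ge_zero all_not_in_conv order_trans)
  \<comment> \<open>The final estimate is \<open>2 * a + 3 * B * b\<close>, and both summands are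
    made at most \<open>e / 2\<close>. The \<open>+ 1\<close> keeps the denominator positive when
    \<open>B = 0\<close>.\<close>
  define a where "a = e / 4"
  define b where "b = e / 4 / (3 * B + 1)"
  have a: "a > 0" and b: "b > 0" using e B0 by (auto simp: a_def b_def)
  have "b * (3 * B + 1) = e / 4" using B0 unfolding b_def by (intro nonzero_eq_divide_eq[THEN iffD1]) auto
  then have Bb: "3 * (B * b) \<le> e / 2" using b e by (simp add: algebra_simps)
  obtain K where K: "compact K" "K \<noteq> {}" "measure P (- K) < b"
    using borel_prob_tight[OF P b] by blast
  obtain d where d: "\<And>x. d x > 0" "\<And>x f y. f \<in> F \<Longrightarrow> dist x y < d x \<Longrightarrow> \<bar>f y - f x\<bar> \<le> a"
    using equi[OF a] by metis
  obtain X where X: "X \<subseteq> K" "finite X" "K \<subseteq> (\<Union>x\<in>X. ball x (d x))"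
  proof (rule compactE_image[OF K(1), of K "\<lambda>x. ball x (d x)"])
    show "K \<subseteq> (\<Union>x\<in>K. ball x (d x))" using d(1) by auto
  qed auto
  \<comment> \<open>The \<open>w x\<close> and the tail \<open>\<tau>\<close> sum to \<open>1\<close>, and \<open>\<tau>\<close> vanishes on \<open>K\<close>.\<close>
  define p where "p x y = max 0 (d x - dist x y)" for x y
  \<comment> \<open>On \<open>K\<close> the cover makes some hat \<open>p x\<close> positive. Off
    \<open>K\<close> all hats may vanish, but there \<open>infdist y K\<close> is positive, as
    \<open>K\<close> is closed and nonempty (\<open>infdist\<close> to the empty set would be 0). So
    division by \<open>S\<close> is safe everywhere.\<close>
  define S where "S y = (\<Sum>x\<in>X. p x y) + infdist y K" for y
  have p0: "p x y \<ge> 0" for x y by (simp add: p_def)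
  have S0: "S y > 0" for y
  proof (cases "y \<in> K")
    case True
    then obtain x where "x \<in> X" "dist x y < d x" using X by auto
    then have "(\<Sum>x\<in>X. p x y) > 0"
      using X p0 by (intro sum_pos2[of X x]) (auto simp: p_def)
    then show ?thesis using infdist_nonneg[of y K] by (simp add: S_def)
  next
    case False
    then have "infdist y K > 0"
      using K by (simp add: compact_imp_closed infdist_pos_not_in_closed)
    then show ?thesis using p0 by (simp add: S_def add_nonneg_pos sum_nonneg)
  qed
  define w where "w x y = p x y / S y" for x y
  define \<tau> where "\<tau> y = infdist y K / S y" for y
  have w0: "w x y \<ge> 0" for x y using S0[of y] p0 by (simp add: w_def)
  have \<tau>0: "\<tau> y \<ge> 0" for y using S0[of y] by (simp add: \<tau>_def infdist_nonneg)
  have part: "(\<Sum>x\<in>X. w x y) + \<tau> y = 1" for y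
    using S0[of y] by (simp add: w_def \<tau>_def S_def sum_divide_distrib[symmetric] add_divide_distrib[symmetric])
  have contS: "continuous_on UNIV S"
    unfolding S_def p_def by (intro continuous_intros)
  have contw: "continuous_on UNIV (w x)" for x
    unfolding w_def p_def using S0 by (intro continuous_intros contS) (auto simp: less_imp_neq[symmetric] dest: less_imp_neq)
  have cont\<tau>: "continuous_on UNIV \<tau>"
    unfolding \<tau>_def using S0 by (intro continuous_intros contS) (metis less_irrefl)
  have \<tau>1: "\<bar>\<tau> y\<bar> \<le> 1" for y
    using part[of y] \<tau>0[of y] sum_nonneg[of X "\<lambda>x. w x y"] w0 by simp
  have w1: "\<bar>w x y\<bar> \<le> 1" if "x \<in> X" for x y
    using part[of y] \<tau>0[of y] member_le_sum[of x X "\<lambda>x. w x y"] w0 X that by simp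
  have contf: "continuous_on UNIV f" if "f \<in> F" for f
    unfolding continuous_on_iff
  proof (intro ballI allI impI)
    fix x :: 'a and r :: real assume "r > 0"
    then obtain s where "s > 0" "\<forall>y. dist x y < s \<longrightarrow> \<bar>f y - f x\<bar> \<le> r / 2"
      using equi[of "r/2" x] \<open>f \<in> F\<close> by auto
    then show "\<exists>s>0. \<forall>y\<in>UNIV. dist y x < s \<longrightarrow> dist (f y) (f x) < r"
      using \<open>r > 0\<close> by (intro exI[of _ s]) (force simp: dist_real_def dist_commute)
  qed
  \<comment> \<open>Split \<open>f y\<close> by the partition of unity. Where \<open>w x y\<close>
    is nonzero, \<open>y\<close> is within \<open>d x\<close> of \<open>x\<close>, so replacing
    \<open>f y\<close> by \<open>f x\<close> costs at most \<open>a\<close>; the weight left to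
    \<tau> costs at most \<open>B\<close>.\<close>
  have approx: "\<bar>f y - (\<Sum>x\<in>X. f x * w x y)\<bar> \<le> a + B * \<tau> y" if f: "f \<in> F" for f y
  proof -
    have "f y = (\<Sum>x\<in>X. f y * w x y) + f y * \<tau> y"
      using part[of y] by (metis distrib_left mult.right_neutral sum_distrib_left)
    then have "f y - (\<Sum>x\<in>X. f x * w x y) = (\<Sum>x\<in>X. (f y - f x) * w x y) + f y * \<tau> y"
      by (simp add: left_diff_distrib sum_subtractf)
    also have "\<bar>\<dots>\<bar> \<le> (\<Sum>x\<in>X. \<bar>f y - f x\<bar> * w x y) + \<bar>f y\<bar> * \<tau> y"
      using sum_abs[of "\<lambda>x. (f y - f x) * w x y" X] w0 \<tau>0 
      by (intro order_trans[OF abs_triangle_ineq]) (simp add: abs_mult)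
    also have "(\<Sum>x\<in>X. \<bar>f y - f x\<bar> * w x y) \<le> (\<Sum>x\<in>X. a * w x y)"
    proof (rule sum_mono)
      fix x
      show "\<bar>f y - f x\<bar> * w x y \<le> a * w x y"
      proof (cases "dist x y < d x")
        case True
        then show ?thesis using d(2)[OF f] w0 by (intro mult_right_mono) auto
      qed (simp add: w_def p_def)
    qed
    also have "(\<Sum>x\<in>X. a * w x y) \<le> a"
      using a part[of y] \<tau>0[of y] by (simp add: sum_distrib_left[symmetric] mult_left_le)
    also have "\<bar>f y\<bar> * \<tau> y \<le> B * \<tau> y"
      using bound[OF f] \<tau>0 by (intro mult_right_mono)
    finally show ?thesis by simp
  qed
  have int_approx: "\<bar>(\<integral>y. f y \<partial>M) - (\<Sum>x\<in>X. f x * (\<integral>y. w x y \<partial>M))\<bar> \<le> a + B * (\<integral>y. \<tau> y \<partial>M)"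
    if f: "f \<in> F" and M: "borel_prob M" for f M
  proof -
    interpret prob_space M using M by (simp add: borel_prob_def)
    note [simp] = integrable_continuous_bounded[OF M contf[OF f] bound[OF f]]
      integrable_continuous_bounded[OF M contw w1] integrable_continuous_bounded[OF M cont\<tau> \<tau>1]
    have "(\<integral>y. f y \<partial>M) - (\<Sum>x\<in>X. f x * (\<integral>y. w x y \<partial>M)) = (\<integral>y. f y - (\<Sum>x\<in>X. f x * w x y) \<partial>M)"
      by (simp add: Bochner_Integration.integral_sum)
    also have "\<bar>\<dots>\<bar> \<le> (\<integral>y. \<bar>f y - (\<Sum>x\<in>X. f x * w x y)\<bar> \<partial>M)"
      by (rule integral_abs_bound)
    also have "\<dots> \<le> (\<integral>y. a + B * \<tau> y \<partial>M)"
      using approx[OF f] by (intro integral_mono) auto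
    also have "\<dots> = a + B * (\<integral>y. \<tau> y \<partial>M)"
      by (simp add: prob_space)
    finally show ?thesis .
  qed
  have \<tau>K: "\<tau> y = 0" if "y \<in> K" for y
    using that by (simp add: \<tau>_def)
  note \<tau>P = integral_tail_less[OF P K(1,3) cont\<tau> \<tau>K \<tau>1]
  have lim: "(\<lambda>n. \<integral>y. f y \<partial>Q n) \<longlonglongrightarrow> (\<integral>y. f y \<partial>P)"
    if "continuous_on UNIV f" "\<And>y. \<bar>f y\<bar> \<le> 1" for f :: "'a \<Rightarrow> real"
    using conv that unfolding converges_in_distribution_def by (auto simp: bounded_iff)
  have "(\<lambda>n. \<Sum>x\<in>X. \<bar>(\<integral>y. w x y \<partial>P) - (\<integral>y. w x y \<partial>Q n)\<bar>)
      \<longlonglongrightarrow> (\<Sum>x\<in>X. \<bar>(\<integral>y. w x y \<partial>P) - (\<integral>y. w x y \<partial>P)\<bar>)"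
    by (intro tendsto_intros lim contw w1)
  then have "\<forall>\<^sub>F n in sequentially. (\<Sum>x\<in>X. \<bar>(\<integral>y. w x y \<partial>P) - (\<integral>y. w x y \<partial>Q n)\<bar>) < b"
    using b by (simp add: order_tendsto_iff)
  moreover have "\<forall>\<^sub>F n in sequentially. (\<integral>y. \<tau> y \<partial>Q n) < b"
    using lim[OF cont\<tau> \<tau>1] \<tau>P by (simp add: order_tendsto_iff)
  ultimately show ?thesis
  proof eventually_elim
    case (elim n)
    show ?case
    proof
      fix f assume f: "f \<in> F"
      \<comment> \<open>The error consists of the approximation errors under \<open>P\<close> and
        under \<open>Q n\<close> and of the distance between the integrated approximants, which is
        estimated first.\<close>
      have "\<bar>(\<Sum>x\<in>X. f x * (\<integral>y. w x y \<partial>P)) - (\<Sum>x\<in>X. f x * (\<integral>y. w x y \<partial>Q n))\<bar>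
          \<le> (\<Sum>x\<in>X. \<bar>f x\<bar> * \<bar>(\<integral>y. w x y \<partial>P) - (\<integral>y. w x y \<partial>Q n)\<bar>)"
        using sum_abs[of "\<lambda>x. f x * ((\<integral>y. w x y \<partial>P) - (\<integral>y. w x y \<partial>Q n))" X]
        by (simp add: sum_subtractf right_diff_distrib abs_mult[symmetric])
      also have "\<dots> \<le> (\<Sum>x\<in>X. B * \<bar>(\<integral>y. w x y \<partial>P) - (\<integral>y. w x y \<partial>Q n)\<bar>)"
        using bound[OF f] by (intro sum_mono mult_right_mono) auto
      also have "\<dots> \<le> B * b"
        unfolding sum_distrib_left[symmetric] using elim B0 by (intro mult_left_mono) auto
      finally have "\<bar>(\<integral>y. f y \<partial>P) - (\<integral>y. f y \<partial>Q n)\<bar>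
          \<le> 2 * a + (B * (\<integral>y. \<tau> y \<partial>P) + B * (\<integral>y. \<tau> y \<partial>Q n)) + B * b"
        using int_approx[OF f P] int_approx[OF f Q[of n]] by linarith
      also have "B * (\<integral>y. \<tau> y \<partial>P) \<le> B * b"
        using \<tau>P B0 by (intro mult_left_mono) auto
      also have "B * (\<integral>y. \<tau> y \<partial>Q n) \<le> B * b"
        using elim B0 by (intro mult_left_mono) auto
      also have "2 * a + (B * b + B * b) + B * b \<le> e"
        using Bb by (simp add: a_def)
      finally show "\<bar>(\<integral>y. f y \<partial>P) - (\<integral>y. f y \<partial>Q n)\<bar> \<le> e" by simp
    qed
  qed
qed simp


section \<open>Double integrals of a bounded continuous kernel under weak convergence\<close>

lemma integral_pair_borel_prob:
  fixes M :: "'a::second_countable_topology measure" and N :: "'b::second_countable_topology measure"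
    and k :: "'a \<Rightarrow> 'b \<Rightarrow> real"
  assumes M: "borel_prob M" and N: "borel_prob N"
    and cont: "continuous_on UNIV (\<lambda>(x, y). k x y)" and bound: "\<And>x y. \<bar>k x y\<bar> \<le> B"
  shows "(\<integral>(x, y). k x y \<partial>(M \<Otimes>\<^sub>M N)) = (\<integral>y. (\<integral>x. k x y \<partial>M) \<partial>N)"
proof -
  interpret M: prob_space M using M by (simp add: borel_prob_def)
  interpret N: prob_space N using N by (simp add: borel_prob_def)
  interpret pair_prob_space M N ..
  \<comment> \<open>By second countability the product \<sigma>-algebra is the Borel one, so joint
    continuity of \<open>k\<close> yields measurability.\<close>
  have "sets (M \<Otimes>\<^sub>M N) = sets borel"
    using M N by (simp add: borel_prob_def borel_prod[symmetric] cong: sets_pair_measure_cong)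
  then have "borel_prob (M \<Otimes>\<^sub>M N)"
    using P.prob_space_axioms by (simp add: borel_prob_def)
  then have "integrable (M \<Otimes>\<^sub>M N) (\<lambda>(x, y). k x y)"
    using bound by (intro integrable_continuous_bounded[where B=B] cont) auto
  then show ?thesis
    by (rule integral_snd[symmetric])
qed

lemma continuous_on_section:
  assumes "continuous_on UNIV (\<lambda>(x, y). k x y)"
  shows "continuous_on UNIV (\<lambda>x. k x y)" "continuous_on UNIV (\<lambda>y. k x y)"
proof -
  have "continuous_on UNIV (\<lambda>x. (x, y))" "continuous_on UNIV (\<lambda>y. (x, y))"
    by (intro continuous_intros)+
  then show "continuous_on UNIV (\<lambda>x. k x y)" "continuous_on UNIV (\<lambda>y. k x y)"
    using continuous_on_compose2[OF assms] by fastforce+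
qed

lemma continuous_on_integral_kernel:
  fixes k :: "'a::topological_space \<Rightarrow> 'b::{first_countable_topology, t2_space} \<Rightarrow> real"
  assumes M: "borel_prob M"
    and cont: "continuous_on UNIV (\<lambda>(x, y). k x y)" and bound: "\<And>x y. \<bar>k x y\<bar> \<le> B"
  shows "continuous_on UNIV (\<lambda>y. \<integral>x. k x y \<partial>M)"
proof -
  interpret prob_space M using M by (simp add: borel_prob_def)
  have "(\<lambda>x. k x y) \<in> borel_measurable M" for y
    using integrable_continuous_bounded[OF M continuous_on_section(1)[OF cont] bound] by simp
  then show ?thesis
    by (rule continuous_on_integral_bounded[OF finite_measure_axioms])
      (use bound continuous_on_section(2)[OF cont] in blast)+
qed

text \<open>In the mixed integral, integrating out \<open>P\<close> leaves a fixed bounded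
  continuous test function \<open>G P\<close>. In the diagonal one the inner function
  \<open>G (Q n)\<close> moves with \<open>n\<close>; it is compared with \<open>G P\<close>,
  uniformly on a ball and crudely by \<open>2 * B\<close> outside.\<close>

lemma weak_convergence_integral_pair:
  fixes P :: "'a::euclidean_space measure" and k :: "'a \<Rightarrow> 'a \<Rightarrow> real"
  assumes P: "borel_prob P" and Q: "\<And>n. borel_prob (Q n)"
    and conv: "converges_in_distribution Q P"
    and cont: "continuous_on UNIV (\<lambda>(x, y). k x y)" and bound: "\<And>x y. \<bar>k x y\<bar> \<le> B"
  shows "(\<lambda>n. \<integral>(x, y). k x y \<partial>(P \<Otimes>\<^sub>M Q n)) \<longlonglongrightarrow> (\<integral>(x, y). k x y \<partial>(P \<Otimes>\<^sub>M P))" (is ?mixed)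
    and "(\<lambda>n. \<integral>(x, y). k x y \<partial>(Q n \<Otimes>\<^sub>M Q n)) \<longlonglongrightarrow> (\<integral>(x, y). k x y \<partial>(P \<Otimes>\<^sub>M P))" (is ?diag)
proof -
  have B0: "B \<ge> 0" using bound by (meson abs_ge_zero order_trans)
  have probs: "prob_space P" "prob_space (Q n)" for n
    using P Q by (auto simp: borel_prob_def)
  note fubini = integral_pair_borel_prob[OF _ _ cont bound]
  define G where "G M y = (\<integral>x. k x y \<partial>M)" for M y
  have contG: "continuous_on UNIV (G M)" if "borel_prob M" for M
    unfolding G_def by (rule continuous_on_integral_kernel[OF that cont bound])
  have boundG: "\<bar>G M y\<bar> \<le> B" if "borel_prob M" for M y
    unfolding G_def using that bound by (intro abs_integral_le_bound) (auto simp: borel_prob_def)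
  have lim: "(\<lambda>n. \<integral>y. f y \<partial>Q n) \<longlonglongrightarrow> (\<integral>y. f y \<partial>P)"
    if "continuous_on UNIV f" "\<And>y. \<bar>f y\<bar> \<le> C" for f :: "'a \<Rightarrow> real" and C
    using conv that unfolding converges_in_distribution_def by (auto simp: bounded_iff)
  show mixed: ?mixed
    using lim[OF contG[OF P] boundG[OF P]] by (simp add: fubini P Q G_def)
  have "(\<lambda>n. (\<integral>y. G P y \<partial>Q n) - (\<integral>y. G (Q n) y \<partial>Q n)) \<longlonglongrightarrow> 0"
  proof (rule LIMSEQ_I)
    fix r :: real assume r: "r > 0"
    \<comment> \<open>The ball contributes \<open>r / 4\<close> and the tail
      \<open>2 * B * b\<close>, which is below \<open>r / 2\<close>.\<close>
    define b where "b = r / 4 / (2 * B + 1)"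
    have b: "b > 0" using r B0 by (simp add: b_def)
    have "b * (2 * B + 1) = r / 4" using B0 unfolding b_def by (intro nonzero_eq_divide_eq[THEN iffD1]) auto
    then have Bb: "2 * (B * b) < r / 2" using b r by (simp add: algebra_simps)
    obtain K where K: "compact K" "measure P (- K) < b"
      using borel_prob_tight[OF P b] by blast
    obtain R where R: "K \<subseteq> cball 0 R"
      using bounded_subset_ballD[OF compact_imp_bounded[OF K(1)], of 0] ball_subset_cball by blast
    \<comment> \<open>This ramp is 0 on \<open>cball 0 R\<close>, hence on \<open>K\<close>, and 1
      outside \<open>cball 0 (R + 1)\<close>; the sections are therefore taken with \<open>y\<close>
      in the larger ball.\<close>
    define \<tau> where "\<tau> y = min 1 (max 0 (norm y - R))" for y :: 'a
    have cont\<tau>: "continuous_on UNIV \<tau>"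
      unfolding \<tau>_def by (intro continuous_intros)
    have \<tau>1: "\<bar>\<tau> y\<bar> \<le> 1" and \<tau>0: "0 \<le> \<tau> y" for y by (auto simp: \<tau>_def)
    have "(\<integral>y. \<tau> y \<partial>P) < b"
      using R by (intro integral_tail_less[OF P K cont\<tau> _ \<tau>1]) (auto simp: \<tau>_def)
    then have "\<forall>\<^sub>F n in sequentially. (\<integral>y. \<tau> y \<partial>Q n) < b"
      using lim[OF cont\<tau> \<tau>1] by (simp add: order_tendsto_iff)
    moreover have "\<forall>\<^sub>F n in sequentially. \<forall>f\<in>(\<lambda>y x. k x y) ` cball 0 (R + 1).
        \<bar>(\<integral>x. f x \<partial>P) - (\<integral>x. f x \<partial>Q n)\<bar> \<le> r / 4"
    proof (rule uniform_weak_convergence[OF P Q conv])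
      fix x :: 'a and e :: real assume e: "e > 0"
      \<comment> \<open>Compactness makes the modulus at \<open>x\<close> independent of
        \<open>y\<close>. The radius \<open>min d 1\<close> below keeps the moved point inside
        \<open>cball x 1\<close>.\<close>
      have "uniformly_continuous_on (cball x 1 \<times> cball 0 (R + 1)) (\<lambda>(x, y). k x y)"
        by (intro compact_uniformly_continuous continuous_on_subset[OF cont] compact_Times) auto
      then obtain d where d: "d > 0"
        "\<And>u v. u \<in> cball x 1 \<times> cball 0 (R + 1) \<Longrightarrow> v \<in> cball x 1 \<times> cball 0 (R + 1) \<Longrightarrow> dist v u < d
          \<Longrightarrow> dist (case v of (x, y) \<Rightarrow> k x y) (case u of (x, y) \<Rightarrow> k x y) < e"
        using e unfolding uniformly_continuous_on_def by metis
      have "\<bar>k x' y - k x y\<bar> \<le> e" if "y \<in> cball 0 (R + 1)" "dist x x' < min d 1" for x' y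
        using d(2)[of "(x, y)" "(x', y)"] that by (simp add: dist_Pair_Pair dist_real_def dist_commute)
      then show "\<exists>d>0. \<forall>f\<in>(\<lambda>y x. k x y) ` cball 0 (R + 1). \<forall>x'. dist x x' < d \<longrightarrow> \<bar>f x' - f x\<bar> \<le> e"
        using d(1) by (intro exI[of _ "min d 1"]) auto
    qed (use bound r in auto)
    ultimately have "\<forall>\<^sub>F n in sequentially. norm ((\<integral>y. G P y \<partial>Q n) - (\<integral>y. G (Q n) y \<partial>Q n) - 0) < r"
    proof eventually_elim
      case (elim n)
      interpret prob_space "Q n" by (rule probs)
      note [simp] = integrable_continuous_bounded[OF Q contG boundG, OF P P, of n]
        integrable_continuous_bounded[OF Q contG boundG, OF Q Q, of n n]
        integrable_continuous_bounded[OF Q cont\<tau> \<tau>1, of n]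
      have pointwise: "\<bar>G P y - G (Q n) y\<bar> \<le> r / 4 + 2 * B * \<tau> y" for y
      proof (cases "norm y \<le> R + 1")
        case True
        then have "\<bar>G P y - G (Q n) y\<bar> \<le> r / 4"
          using elim(2) by (auto simp: G_def)
        then show ?thesis using B0 \<tau>0[of y] by (simp add: add_increasing2)
      next
        case False
        then have "\<tau> y = 1" by (simp add: \<tau>_def)
        then show ?thesis using boundG[OF P, of y] boundG[OF Q, of n y] r by simp
      qed
      have "(\<integral>y. G P y \<partial>Q n) - (\<integral>y. G (Q n) y \<partial>Q n) = (\<integral>y. G P y - G (Q n) y \<partial>Q n)"
        by simp
      also have "\<bar>\<dots>\<bar> \<le> (\<integral>y. \<bar>G P y - G (Q n) y\<bar> \<partial>Q n)"
        by (rule integral_abs_bound)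
      also have "\<dots> \<le> (\<integral>y. r / 4 + 2 * B * \<tau> y \<partial>Q n)"
        using pointwise by (intro integral_mono) auto
      also have "\<dots> = r / 4 + 2 * B * (\<integral>y. \<tau> y \<partial>Q n)"
        by (simp add: prob_space)
      also have "\<dots> \<le> r / 4 + 2 * B * b"
        using elim B0 by (intro add_mono mult_left_mono) auto
      also have "\<dots> < r"
        using Bb r by simp
      finally show ?case by simp
    qed
    then show "\<exists>N. \<forall>n\<ge>N. norm ((\<integral>y. G P y \<partial>Q n) - (\<integral>y. G (Q n) y \<partial>Q n) - 0) < r"
      by (simp add: eventually_sequentially)
  qed
  from tendsto_diff[OF mixed this] show ?diag
    by (simp add: fubini P Q G_def)
qed

lemma mmd_sq_tendsto_0:
  fixes P :: "'a::euclidean_space measure" and k :: "'a \<Rightarrow> 'a \<Rightarrow> real"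
  assumes P: "borel_prob P" and Q: "\<And>n. borel_prob (Q n)"
    and conv: "converges_in_distribution Q P"
    and cont: "continuous_on UNIV (\<lambda>(x, y). k x y)" and bound: "\<And>x y. \<bar>k x y\<bar> \<le> B"
  shows "(\<lambda>n. mmd_sq k P (Q n)) \<longlonglongrightarrow> 0"
proof -
  define c where "c = (\<integral>(x, y). k x y \<partial>(P \<Otimes>\<^sub>M P))"
  \<comment> \<open>The first integral is constant in \<open>n\<close>, and the other two converge
    to the same value \<open>c\<close>.\<close>
  have "(\<lambda>n. mmd_sq k P (Q n)) \<longlonglongrightarrow> c - 2 * c + c"
    unfolding mmd_sq_def c_def
    by (intro tendsto_intros weak_convergence_integral_pair[OF P Q conv cont bound])
  then show ?thesis by simp
qed

subsection \<open>Reproducing kernel Hilbert spaces\<close>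

context rkhs
begin

lemma kernel_sym: "k x y = k y x"
  using ip_sym[OF kernel_mem[of x] kernel_mem[of y]] reproducing[OF kernel_mem] by simp

lemma ip_add_right: "\<lbrakk>f \<in> H; f' \<in> H; u \<in> H\<rbrakk> \<Longrightarrow> ip u (\<lambda>x. f x + f' x) = ip u f + ip u f'"
  by (simp add: ip_sym[of u] add_mem ip_add)

lemma ip_scale_right: "\<lbrakk>f \<in> H; u \<in> H\<rbrakk> \<Longrightarrow> ip u (\<lambda>x. c * f x) = c * ip u f"
  by (simp add: ip_sym[of u] scale_mem ip_scale)

lemma ip_Cauchy_Schwarz:
  assumes f: "f \<in> H" and u: "u \<in> H"
  shows "(ip f u)\<^sup>2 \<le> ip f f * ip u u"
proof (cases "ip u u = 0")
  case True
  \<comment> \<open>Writing the zero function as a multiple by 0 lets the scaling law give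
    \<open>ip f u = 0\<close>.\<close>
  then have "u = (\<lambda>x. 0 * u x)" using ip_definite[OF u] by auto
  then have "ip f u = 0" using ip_scale_right[OF u f, of 0] by simp
  then show ?thesis using True by simp
next
  case False
  then have pos: "ip u u > 0" using ip_nonneg[OF u] by simp
  \<comment> \<open>This is the minimiser of the squared norm of \<open>f + c * u\<close> as a
    quadratic in \<open>c\<close>.\<close>
  define c where "c = - ip f u / ip u u"
  have "0 \<le> ip (\<lambda>x. f x + c * u x) (\<lambda>x. f x + c * u x)"
    by (intro ip_nonneg add_mem scale_mem f u)
  also have "\<dots> = ip f f + 2 * c * ip f u + c\<^sup>2 * ip u u"
    using f u by (simp add: ip_add ip_add_right ip_scale ip_scale_right add_mem scale_mem ip_sym[OF u f]
        power2_eq_square algebra_simps)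
  also have "\<dots> = ip f f - (ip f u)\<^sup>2 / ip u u"
    using pos by (simp add: c_def power2_eq_square field_simps)
  finally show ?thesis
    using pos by (simp add: field_simps)
qed

lemma eval_bound:
  assumes "f \<in> H"
  shows "(f x)\<^sup>2 \<le> ip f f * k x x"
  using ip_Cauchy_Schwarz[OF assms kernel_mem] by (simp add: reproducing assms kernel_mem)

text \<open>The functional \<open>f x - f y\<close> is represented by \<open>k x - k y\<close>,
  whose squared norm is the bracket on the right; Cauchy-Schwarz does the rest. For continuous
  \<open>k\<close> this makes the unit ball equicontinuous.\<close>

lemma eval_diff_bound:
  assumes f: "f \<in> H"
  shows "(f x - f y)\<^sup>2 \<le> ip f f * (k x x - 2 * k x y + k y y)"
proof -
  define u where "u = (\<lambda>z. k x z + (-1) * k y z)"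
  have u: "u \<in> H" unfolding u_def by (intro add_mem scale_mem kernel_mem)
  have ip_u: "ip v u = v x - v y" if v: "v \<in> H" for v
  proof -
    have "ip v u = ip v (k x) + ip v (\<lambda>z. (-1) * k y z)"
      unfolding u_def by (intro ip_add_right scale_mem kernel_mem v)
    also have "ip v (\<lambda>z. (-1) * k y z) = (-1) * ip v (k y)"
      by (intro ip_scale_right kernel_mem v)
    finally show ?thesis by (simp add: reproducing v)
  qed
  have "ip u u = k x x - 2 * k x y + k y y"
    using kernel_sym[of x y] by (simp add: ip_u[OF u]) (simp add: u_def)
  then show ?thesis
    using ip_Cauchy_Schwarz[OF f u] ip_u[OF f] by simp
qed

end

text \<open>The unit ball is a bounded equicontinuous family, so uniform weak convergence bounds the
  whole supremum. The zero function keeps the supremum nonnegative.\<close>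

lemma mmd_tendsto_0:
  fixes P :: "'a::heine_borel measure" and k :: "'a \<Rightarrow> 'a \<Rightarrow> real"
  assumes rkhs: "rkhs H ip k"
    and P: "borel_prob P" and Q: "\<And>n. borel_prob (Q n)"
    and conv: "converges_in_distribution Q P"
    and cont: "continuous_on UNIV (\<lambda>(x, y). k x y)" and bound: "\<And>x y. \<bar>k x y\<bar> \<le> B"
  shows "(\<lambda>n. mmd H ip P (Q n)) \<longlonglongrightarrow> 0"
proof (rule order_tendstoI)
  interpret rkhs H ip k by (rule rkhs)
  let ?U = "{f \<in> H. rkhs_norm ip f \<le> 1}"
  have unit: "ip f f \<le> 1" if "f \<in> ?U" for f
    using that by (auto simp: rkhs_norm_def)
  have "(\<lambda>x. 0) \<in> ?U"
    using zero_mem ip_scale[OF zero_mem zero_mem, of 0] by (simp add: rkhs_norm_def)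
  then have nonneg: "0 \<le> mmd H ip P (Q n)" for n
    unfolding mmd_def by (intro SUP_upper2[where i="\<lambda>x. 0"]) auto
  show "\<forall>\<^sub>F n in sequentially. a < mmd H ip P (Q n)" if "a < 0" for a
    using less_le_trans[OF that nonneg] by simp
  fix a :: ereal assume "0 < a"
  \<comment> \<open>The threshold \<open>a\<close> may be infinite, so a real number below it is
    used.\<close>
  then obtain e where e: "0 < e" "ereal e < a"
    using ereal_dense2[of 0 a] by (auto simp: zero_ereal_def)
  have "\<forall>\<^sub>F n in sequentially. \<forall>f\<in>?U. \<bar>(\<integral>x. f x \<partial>P) - (\<integral>x. f x \<partial>Q n)\<bar> \<le> e"
  proof (rule uniform_weak_convergence[OF P Q conv])
    fix x :: 'a and e :: real assume e: "e > 0"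
    \<comment> \<open>\<open>D y\<close> is the squared distance between \<open>k y\<close> and
      \<open>k x\<close> in the Hilbert space. As \<open>D x = 0\<close>, continuity makes it
      smaller than \<open>e\<^sup>2\<close> near \<open>x\<close>.\<close>
    define D where "D y = k y y - 2 * k y x + k x x" for y
    have "continuous_on UNIV (\<lambda>y. case (y, y) of (x, y) \<Rightarrow> k x y)"
      by (rule continuous_on_compose2[OF cont]) (auto intro!: continuous_intros)
    then have "continuous_on UNIV D"
      unfolding D_def by (intro continuous_intros continuous_on_section[OF cont]) simp
    then obtain d where d: "d > 0" "\<And>y. dist y x < d \<Longrightarrow> dist (D y) (D x) < e\<^sup>2"
      using e unfolding continuous_on_iff by (metis UNIV_I zero_less_power)
    have "\<bar>f y - f x\<bar> \<le> e" if f: "f \<in> ?U" and y: "dist x y < d" for f y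
    proof -
      have "(f y - f x)\<^sup>2 \<le> ip f f * D y"
        using f unfolding D_def by (intro eval_diff_bound) simp
      also have "\<dots> \<le> ip f f * e\<^sup>2"
        using d(2)[of y] y f by (intro mult_left_mono ip_nonneg) (auto simp: dist_real_def D_def dist_commute)
      also have "\<dots> \<le> 1 * e\<^sup>2"
        using unit[OF f] by (intro mult_right_mono) auto
      finally show ?thesis using e by (simp add: abs_le_square_iff[symmetric])
    qed
    then show "\<exists>d>0. \<forall>f\<in>?U. \<forall>y. dist x y < d \<longrightarrow> \<bar>f y - f x\<bar> \<le> e"
      using d(1) by blast
  next
    fix f x assume f: "f \<in> ?U"
    have "(f x)\<^sup>2 \<le> ip f f * k x x" using f by (intro eval_bound) simp
    also have "\<dots> \<le> ip f f * B" using f bound[of x x] by (intro mult_left_mono ip_nonneg) auto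
    also have "\<dots> \<le> 1 * B" using bound[of x x] unit[OF f] by (intro mult_right_mono) auto
    finally show "\<bar>f x\<bar> \<le> sqrt B" by (simp add: real_le_rsqrt)
  qed (use e in auto)
  then show "\<forall>\<^sub>F n in sequentially. mmd H ip P (Q n) < a"
  proof eventually_elim
    case (elim n)
    then have "mmd H ip P (Q n) \<le> ereal e"
      unfolding mmd_def by (intro SUP_least) (auto simp: abs_le_iff)
    then show ?case using e by simp
  qed
qed

subsection \<open>The KernelNet kernel\<close>

lemma prob_space_uniform_cube: "prob_space (uniform_cube :: (real^'d) measure)"
  unfolding uniform_cube_def
proof (rule prob_space_uniform_measure)
  have one: "(1::real^'d) \<bullet> b = 1" if "b \<in> Basis" for b
    using that by (auto simp: Basis_vec_def inner_axis one_vec_def)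
  \<comment> \<open>The vector \<open>2\<close> is the difference of the two corners of the
    cube.\<close>
  have "(2::real^'d) \<bullet> b = 2" if "b \<in> Basis" for b
    using one[OF that] inner_add_left[of "1::real^'d" 1 b] by simp
  then show "emeasure lborel (cbox (-1) (1::real^'d)) \<noteq> 0"
    by (simp add: emeasure_lborel_cbox_eq one)
qed (simp add: emeasure_lborel_cbox_eq)

lemma prob_space_uniform_phase: "prob_space uniform_phase"
  unfolding uniform_phase_def by (rule prob_space_uniform_measure) auto

lemma prob_space_std_gaussian: "prob_space (std_gaussian :: (real^'d) measure)"
proof
  \<comment> \<open>Indexing the product by \<open>Basis\<close> matches the product rule for
    \<open>lborel\<close>, which splits the integral into one-dimensional Gaussian integrals equal
    to 1.\<close>
  have "(\<Prod>i\<in>UNIV. std_normal_density (x $ i)) = (\<Prod>b\<in>Basis. std_normal_density (x \<bullet> b))"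
    for x :: "real^'d"
    unfolding Basis_vec_def
    by (subst prod.UNION_disjoint) (auto simp: axis_eq_axis inner_axis)
  then have "emeasure (std_gaussian :: (real^'d) measure) (space std_gaussian)
      = (\<integral>\<^sup>+x. (\<Prod>b\<in>Basis. ennreal (std_normal_density (x \<bullet> b))) \<partial>(lborel :: (real^'d) measure))"
    by (simp add: std_gaussian_def emeasure_density prod_ennreal)
  also have "\<dots> = 1"
    by (subst nn_integral_lborel_prod) (simp_all add: nn_integral_eq_integral)
  finally show "emeasure (std_gaussian :: (real^'d) measure) (space std_gaussian) = 1" .
qed

text \<open>The common form of both kernels: \<open>z\<close> will be a pair of points with
  \<open>fst\<close> and \<open>snd\<close> as \<open>z1\<close> and \<open>z2\<close>, and the
  frequency \<open>W\<close> may vary with the pair. The integrand is bounded by 2 and continuous in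
  \<open>z\<close> for fixed noise and phase.\<close>

lemma phase_average:
  fixes W :: "'a::{first_countable_topology, t2_space} \<Rightarrow> 'e \<Rightarrow> 'b::euclidean_space" and z1 z2 :: "'a \<Rightarrow> 'b"
  assumes M: "prob_space M"
    and meas: "\<And>z. W z \<in> borel_measurable M"
    and cont: "\<And>\<epsilon>. continuous_on UNIV (\<lambda>z. W z \<epsilon>)" "continuous_on UNIV z1" "continuous_on UNIV z2"
  defines "I \<equiv> \<lambda>z. \<integral>(\<epsilon>, b). 2 * cos (W z \<epsilon> \<bullet> z1 z + b) * cos (W z \<epsilon> \<bullet> z2 z + b) \<partial>(M \<Otimes>\<^sub>M uniform_phase)"
  shows continuous_on_phase_average: "continuous_on UNIV I"
    and phase_average_bound: "\<bar>I z\<bar> \<le> 2"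
proof -
  let ?f = "\<lambda>z (\<epsilon>, b). 2 * cos (W z \<epsilon> \<bullet> z1 z + b) * cos (W z \<epsilon> \<bullet> z2 z + b)"
  have prob: "prob_space (M \<Otimes>\<^sub>M uniform_phase)"
    by (intro prob_space_pair M prob_space_uniform_phase)
  have bound: "\<bar>?f z p\<bar> \<le> 2" for z p
    by (cases p) (auto simp: abs_mult intro!: mult_le_one)
  show "\<bar>I z\<bar> \<le> 2"
    unfolding I_def by (rule abs_integral_le_bound[OF prob bound])
  note [measurable] = meas
  have [measurable_cong]: "sets uniform_phase = sets borel" by (simp add: uniform_phase_def)
  show "continuous_on UNIV I"
    unfolding I_def
  proof (rule continuous_on_integral_bounded[OF _ _ _ bound])
    show "finite_measure (M \<Otimes>\<^sub>M uniform_phase)" using prob by (simp add: prob_space_def)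
    show "?f z \<in> borel_measurable (M \<Otimes>\<^sub>M uniform_phase)" for z by measurable
    show "continuous_on UNIV (\<lambda>z. ?f z p)" for p
      unfolding split_def by (intro continuous_intros cont)
  qed
qed

lemma continuous_on_times_vec:
  fixes f g :: "'a::topological_space \<Rightarrow> real^'d"
  assumes "continuous_on S f" "continuous_on S g"
  shows "continuous_on S (\<lambda>x. f x * g x)"
  unfolding times_vec_def by (intro continuous_intros assms)

lemma continuous_on_omega2:
  fixes t :: "'q \<Rightarrow> real^'d \<Rightarrow> real^'d"
  assumes t: "continuous_on UNIV (t (fst \<psi>2))" "continuous_on UNIV (t (snd \<psi>2))"
    and "continuous_on S e" "continuous_on S u" "continuous_on S v"
  shows "continuous_on S (\<lambda>x. omega2 t \<psi>2 (e x) (u x) (v x))"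
  unfolding omega2_def mu2_def sigma2_def exp_vec_def
  by (intro continuous_intros continuous_on_times_vec assms
      continuous_on_compose2[OF t(1)] continuous_on_compose2[OF t(2)] subset_UNIV)

lemma lip_const_finite_imp_continuous:
  assumes "lip_const h < \<infinity>"
  shows "continuous_on UNIV h"
proof -
  \<comment> \<open>An infimum over the empty set would be \<infinity>, so finiteness provides an
    actual Lipschitz constant.\<close>
  have "{L. L-lipschitz_on UNIV h} \<noteq> {}"
    using assms unfolding lip_const_def by (metis INF_empty infinity_ennreal_def less_irrefl)
  then show ?thesis by (auto intro: lipschitz_on_continuous_on)
qed

section \<open>Continuity and boundedness of the two kernel summands, and the conclusion\<close>

lemma kappa1_continuous_bounded:
  fixes g :: "'p \<Rightarrow> real^'m \<Rightarrow> real^'d"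
  assumes \<nu>: "\<nu> = uniform_cube \<or> \<nu> = std_gaussian" and g: "g \<psi>1 \<in> borel_measurable borel"
  shows "continuous_on UNIV (\<lambda>(z1, z2). kappa1 \<nu> g \<psi>1 z1 z2)" "\<bar>kappa1 \<nu> g \<psi>1 z1 z2\<bar> \<le> 2"
proof -
  have prob: "prob_space \<nu>" and sets: "sets \<nu> = sets borel"
    using \<nu> prob_space_uniform_cube prob_space_std_gaussian
    by (auto simp: uniform_cube_def std_gaussian_def)
  have meas: "g \<psi>1 \<in> borel_measurable \<nu>"
    using g by (simp add: sets cong: measurable_cong_sets)
  show "continuous_on UNIV (\<lambda>(z1, z2). kappa1 \<nu> g \<psi>1 z1 z2)"
    unfolding kappa1_def split_def
    using continuous_on_phase_average[OF prob meas, of fst snd] by (simp add: split_def continuous_on_const continuous_on_fst continuous_on_snd continuous_on_id)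
  show "\<bar>kappa1 \<nu> g \<psi>1 z1 z2\<bar> \<le> 2"
    unfolding kappa1_def
    using phase_average_bound[OF prob meas, of fst snd "(z1, z2)"] by (simp add: continuous_on_const continuous_on_fst continuous_on_snd continuous_on_id)
qed

lemma kappa2_continuous_bounded:
  fixes t :: "'q \<Rightarrow> real^'d \<Rightarrow> real^'d"
  assumes t: "continuous_on UNIV (t (fst \<psi>2))" "continuous_on UNIV (t (snd \<psi>2))"
  shows "continuous_on UNIV (\<lambda>(z1, z2). kappa2 t \<psi>2 z1 z2)" "\<bar>kappa2 t \<psi>2 z1 z2\<bar> \<le> 2"
proof -
  \<comment> \<open>Here the frequency depends on the pair of points, so it must be measurable in
    the noise for each pair and continuous in the pair for each noise value.\<close>
  have meas: "(\<lambda>\<epsilon>. omega2 t \<psi>2 \<epsilon> (fst z) (snd z)) \<in> borel_measurable uniform_cube" for z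
    using borel_measurable_continuous_onI[OF continuous_on_omega2[OF t continuous_on_id continuous_on_const continuous_on_const]]
    by (simp add: uniform_cube_def cong: measurable_cong_sets)
  have cont: "continuous_on UNIV (\<lambda>z. omega2 t \<psi>2 \<epsilon> (fst z) (snd z))" for \<epsilon>
    by (intro continuous_on_omega2 t continuous_intros)
  show "continuous_on UNIV (\<lambda>(z1, z2). kappa2 t \<psi>2 z1 z2)"
    unfolding kappa2_def split_def
    using continuous_on_phase_average[OF prob_space_uniform_cube meas cont, of fst snd]
    by (simp add: split_def continuous_on_const continuous_on_fst continuous_on_snd continuous_on_id)
  show "\<bar>kappa2 t \<psi>2 z1 z2\<bar> \<le> 2"
    unfolding kappa2_def
    using phase_average_bound[OF prob_space_uniform_cube meas cont, of fst snd "(z1, z2)"]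
    by (simp add: continuous_on_const continuous_on_fst continuous_on_snd continuous_on_id)
qed

theorem theorem5:
  fixes \<Phi> :: "'\<phi> set"
    and h :: "'\<phi> \<Rightarrow> real^'D \<Rightarrow> real^'d"
    and \<nu> :: "(real^'m) measure"
    and g :: "'p \<Rightarrow> real^'m \<Rightarrow> real^'d"
    and t :: "'q \<Rightarrow> real^'d \<Rightarrow> real^'d"
    and \<psi>1 :: 'p and \<psi>21 \<psi>22 :: 'q
    and \<phi> :: '\<phi>
    and k :: "real^'D \<Rightarrow> real^'D \<Rightarrow> real"
    and P :: "(real^'D) measure" and Q :: "nat \<Rightarrow> (real^'D) measure"
  defines "k \<equiv> \<lambda>x y. kappa \<nu> g t (\<psi>1, (\<psi>21, \<psi>22)) (h \<phi> x) (h \<phi> y)"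
  assumes inj_h: "\<And>\<phi>. \<phi> \<in> \<Phi> \<Longrightarrow> inj (h \<phi>)"
    and noise: "\<nu> = uniform_cube \<or> \<nu> = std_gaussian"
    and g_meas: "g \<psi>1 \<in> borel_measurable borel"
    and t1_diff: "t \<psi>21 differentiable_on UNIV"
    and t2_diff: "t \<psi>22 differentiable_on UNIV"
    and moment1: "(\<integral>\<^sup>+ \<epsilon>. ennreal ((norm (g \<psi>1 \<epsilon>))\<^sup>2) \<partial>\<nu>) < \<infinity>"
    and moment2: "\<And>z1 z2. (\<integral>\<^sup>+ \<epsilon>. ennreal ((norm (omega2 t (\<psi>21, \<psi>22) \<epsilon> z1 z2))\<^sup>2) \<partial>uniform_cube) < \<infinity>"
    and jacobian_moment:
      "\<And>z1 z2. (\<integral>\<^sup>+ \<epsilon>. ennreal (norm (jacobian_diff t (\<psi>21, \<psi>22) \<epsilon> z1 z2)) \<partial>uniform_cube) < \<infinity>"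
    and lip: "(SUP \<phi>\<in>\<Phi>. lip_const (h \<phi>)) < \<infinity>"
    and phi: "\<phi> \<in> \<Phi>"
    and P: "borel_prob P"
    and Q: "\<And>n. borel_prob (Q n)"
    and conv: "converges_in_distribution Q P"
  shows "(\<forall>H ip. rkhs H ip k \<longrightarrow> (\<lambda>n. mmd H ip P (Q n)) \<longlonglongrightarrow> 0) \<and>
         (\<lambda>n. mmd_sq k P (Q n)) \<longlonglongrightarrow> 0"
proof -
  have "lip_const (h \<phi>) < \<infinity>"
    using lip phi by (meson SUP_upper le_less_trans)
  then have h: "continuous_on UNIV (h \<phi>)"
    by (rule lip_const_finite_imp_continuous)
  have t: "continuous_on UNIV (t (fst (\<psi>21, \<psi>22)))" "continuous_on UNIV (t (snd (\<psi>21, \<psi>22)))"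
    using t1_diff t2_diff by (simp_all add: differentiable_imp_continuous_on)
  note k1 = kappa1_continuous_bounded[of \<nu> g \<psi>1, OF noise g_meas]
  note k2 = kappa2_continuous_bounded[of t "(\<psi>21, \<psi>22)", OF t]
  have "continuous_on UNIV (\<lambda>z. kappa \<nu> g t (\<psi>1, (\<psi>21, \<psi>22)) (fst z) (snd z))"
    using continuous_on_add[OF k1(1) k2(1)] by (simp add: kappa_def split_def)
  moreover have "continuous_on UNIV (\<lambda>z. (h \<phi> (fst z), h \<phi> (snd z)))"
    by (intro continuous_intros continuous_on_compose2[OF h] subset_UNIV)
  ultimately have cont: "continuous_on UNIV (\<lambda>(x, y). k x y)"
    using continuous_on_compose2[of UNIV _ UNIV "\<lambda>z. (h \<phi> (fst z), h \<phi> (snd z))"]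
    by (fastforce simp: k_def split_def)
  \<comment> \<open>Each of the two summands of \<open>kappa\<close> contributes at most 2.\<close>
  have bound: "\<bar>k x y\<bar> \<le> 4" for x y
    using k1(2)[of "h \<phi> x" "h \<phi> y"] k2(2)[of "h \<phi> x" "h \<phi> y"] by (simp add: k_def kappa_def)
  show ?thesis
    using mmd_tendsto_0[OF _ P Q conv cont bound] mmd_sq_tendsto_0[OF P Q conv cont bound] by blast
qed

end
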